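(* For every integer $p\ge2$, the probability density function of the random eigenvalue $\Lambda^*_{p,p}$ of a dual $(p,p)$-nanotube is given by $$f_{\Lambda^*_{p,p}}(x)=\frac1p\left(\frac12f_0(x)+\sum_{j=1}^{p-1}f_j(x)\right),$$ where $$f_0(x)=\frac{\mathbf{1}\{0<x<9\}}{\pi\sqrt{x(3+2\sqrt{x}-x)}}+\frac{\mathbf{1}\{0<x<1\}}{\pi\sqrt{x(3-2\sqrt{x}-x)}},$$ and, for $j\in\{1,\ldots,p-1\}$ and $a_j:=\cos\left(\frac{j\pi}{p}\right)$, $f_j$ is the probability density function of $4\cos^2(\mathcal{V})+4a_j\cos(\mathcal{V})+1$ with $\mathcal{V}$ uniformly distributed on $(0,\frac{\pi}{2})$, and it equals $$f_j(x)=\frac{\mathbf{1}\{1\le x<5+4a_j\}}{\pi\sqrt{\left(4-\left(-a_j+\sqrt{a_j^2+x-1}\right)^2\right)(a_j^2+x-1)}}\quad\text{if }2j\le p,$$ $$f_j(x)=\frac{1}{\pi\sqrt{a_j^2+x-1}}\left(\frac{\mathbf{1}\{1-a_j^2<x<1\}}{\sqrt{4-\left(a_j+\sqrt{a_j^2+x-1}\right)^2}}+\frac{\mathbf{1}\{1-a_j^2<x<5+4a_j\}}{\sqrt{4-\left(-a_j+\sqrt{a_j^2+x-1}\right)^2}}\right)\quad\text{if }2j>p.$$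
   Context: $\mathbb{N}_0=\{0,1,2,\ldots\}$. For $(p,q)\in\mathbb{N}_0^2$ with $q\le p$ and $p\ge1$, $\Lambda^*_{p,q}$ denotes the random eigenvalue of the dual infinite $(p,q)$-nanotube (the triangular lattice with a loop of weight $3$ at each vertex, rolled up along the chiral vector $(p,q)$), i.e. the real random variable with compactly supported distribution whose moments $\mu_k(\Lambda^*_{p,q})=\mathbb{E}(\Lambda^*_{p,q})^k$, $k\in\mathbb{N}_0$, are the (weighted) numbers of closed paths with $k$ steps from a vertex of this graph, given by $$\mu_k(\Lambda^*_{p,q})=\frac{1}{(2\pi)^3}\sum_{j\in\mathbb{Z}}\int_{-\pi}^{\pi}\int_{-\pi}^{\pi}\int_{-\pi}^{\pi}\left|e^{ix}+e^{iy}+e^{iz}\right|^{2k}e^{ij(p(x-z)+q(y-z))}\,dx\,dy\,dz .$$ For each fixed $k$ only finitely many terms of the sum are non-zero, and these moments determine the (compactly supported) distribution of $\Lambda^*_{p,q}$ uniquely. Terms whose indicator vanishes are understood as $0$; density formulas are understood up to Lebesgue-null sets (e.g. at points where a denominator vanishes). *)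

theory Defs
  imports "HOL-Probability.Probability"
begin

text \<open>
  The weighted number of closed paths with \<open>k\<close> steps from a vertex of the dual infinite
  \<open>(p,q)\<close>-nanotube. For fixed \<open>k\<close> only finitely many summands are non-zero, so the infinite
  sum is in fact finite. The value is real, but the integrals are taken over the complex numbers.
\<close>

definition dual_nanotube_moment :: "nat \<Rightarrow> nat \<Rightarrow> nat \<Rightarrow> complex" where
  "dual_nanotube_moment p q k =
     1 / (2 * of_real pi) ^ 3 *
     (\<Sum>\<^sub>\<infinity>j\<in>(UNIV :: int set).
        integral {-pi..pi} (\<lambda>z. integral {-pi..pi} (\<lambda>y. integral {-pi..pi} (\<lambda>x.
          of_real (norm (cis x + cis y + cis z) ^ (2 * k)) *
          cis (real_of_int j * (real p * (x - z) + real q * (y - z)))))))"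

text \<open>
  The distribution of the random eigenvalue of the dual \<open>(p,q)\<close>-nanotube: the compactly supported
  Borel probability measure on the real line with the above moments. As this is a definite
  description, identifying it includes proving existence and uniqueness.
\<close>

definition dual_nanotube_law :: "nat \<Rightarrow> nat \<Rightarrow> real measure" where
  "dual_nanotube_law p q = (THE N.
     prob_space N \<and> sets N = sets borel \<and>
     (\<exists>K. compact K \<and> (AE x in N. x \<in> K)) \<and>
     (\<forall>k. complex_of_real (\<integral>x. x ^ k \<partial>N) = dual_nanotube_moment p q k))"

definition nanotube_angle_cos :: "nat \<Rightarrow> nat \<Rightarrow> real" where
  "nanotube_angle_cos p j = cos (real j * pi / real p)"

text \<open>
  In the following formulas the factor multiplying an indicator may be meaningless (root of a
  negative number, division by zero) outside the indicated set; multiplication by 0 makes the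
  term vanish there. Since division by zero yields 0, this also fixes a value at the
  boundary points at which a denominator vanishes; these form a null set.
  Note that \<open>dual_armchair_f0\<close> has total mass 2, whence the factor 1/2 in the mixture below.
\<close>

definition dual_armchair_f0 :: "real \<Rightarrow> real" where
  "dual_armchair_f0 x =
     indicator {0<..<9} x / (pi * sqrt (x * (3 + 2 * sqrt x - x))) +
     indicator {0<..<1} x / (pi * sqrt (x * (3 - 2 * sqrt x - x)))"

definition dual_armchair_f :: "nat \<Rightarrow> nat \<Rightarrow> real \<Rightarrow> real" where
  "dual_armchair_f p j x =
     (let a = nanotube_angle_cos p j in
      if 2 * j \<le> p then
        indicator {1..<5 + 4 * a} x /
          (pi * sqrt ((4 - (- a + sqrt (a\<^sup>2 + x - 1))\<^sup>2) * (a\<^sup>2 + x - 1)))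
      else
        1 / (pi * sqrt (a\<^sup>2 + x - 1)) *
          (indicator {1 - a\<^sup>2<..<1} x / sqrt (4 - (a + sqrt (a\<^sup>2 + x - 1))\<^sup>2) +
           indicator {1 - a\<^sup>2<..<5 + 4 * a} x / sqrt (4 - (- a + sqrt (a\<^sup>2 + x - 1))\<^sup>2)))"

definition dual_armchair_density :: "nat \<Rightarrow> real \<Rightarrow> real" where
  "dual_armchair_density p x =
     1 / real p * (1 / 2 * dual_armchair_f0 x + (\<Sum>j = 1..p - 1. dual_armchair_f p j x))"

end

theory Submission
  imports Defs
begin

text \<open>
  Expanding \<open>norm (1 + cis u + cis v) ^ (2 * k)\<close> into monomials \<open>cis (m * u + n * v)\<close>, the moment of
  order \<open>k\<close> counts the monomials with \<open>m = n\<close> divisible by \<open>p\<close>. For \<open>u = s + t\<close>, \<open>v = s - t\<close> the squared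
  norm is \<open>4 * (cos t)\<^sup>2 + 4 * cos s * cos t + 1\<close>, and by orthogonality of characters the same count
  arises by averaging the \<open>k\<close>-th power of this expression over \<open>t\<close> in the circle and \<open>s\<close> in the \<open>p\<close>
  points \<open>l * pi / p\<close>. Pairing \<open>l\<close> with \<open>p - l\<close> reduces \<open>t\<close> to the interval from \<open>0\<close> to \<open>pi / 2\<close>, where
  the density is computed on the intervals of monotonicity. A boundedly supported law is determined by
  its moments because its characteristic function is the sum of its moment series.
\<close>

section \<open>Determinacy by moments\<close>

lemma (in real_distribution) moment_support_bound:
  assumes "AE x in M. \<bar>x\<bar> \<le> K"
  shows "integrable M (\<lambda>x. x ^ k)" and "expectation (\<lambda>x. \<bar>x\<bar> ^ k) \<le> K ^ k"
proof -
  have AE: "AE x in M. norm (x ^ k) \<le> K ^ k"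
    using assms by eventually_elim (auto simp: power_abs intro: power_mono)
  show int: "integrable M (\<lambda>x. x ^ k)"
    using AE by (intro integrable_const_bound[where B = "K ^ k"]) auto
  have "integrable M (\<lambda>x. \<bar>x\<bar> ^ k)"
    using integrable_norm[OF int] by (simp add: power_abs)
  then have "expectation (\<lambda>x. \<bar>x\<bar> ^ k) \<le> expectation (\<lambda>_. K ^ k)"
    using AE by (intro integral_mono_AE) (auto simp: power_abs)
  then show "expectation (\<lambda>x. \<bar>x\<bar> ^ k) \<le> K ^ k"
    using prob_space by simp
qed

text \<open>The Taylor remainder of order \<open>n\<close> of the characteristic function is at most
  \<open>2 * \<bar>t\<bar> ^ n / fact n\<close> times the absolute moment of order \<open>n\<close>,
  hence at most \<open>2 * (\<bar>t\<bar> * K) ^ n / fact n\<close>, which tends to 0. Equal moments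
  mean that both laws share the Taylor sums \<open>S\<close>, so both characteristic functions are
  the limit of \<open>S\<close>.\<close>

lemma moments_determine_bounded_distribution:
  assumes "real_distribution M1" "real_distribution M2"
    and bounded: "AE x in M1. \<bar>x\<bar> \<le> K" "AE x in M2. \<bar>x\<bar> \<le> K"
    and moments: "\<And>k. (\<integral>x. x ^ k \<partial>M1) = (\<integral>x. x ^ k \<partial>M2)"
  shows "M1 = M2"
proof (rule Levy_uniqueness[OF assms(1,2)], rule ext)
  fix t :: real
  interpret M1: real_distribution M1 by fact
  interpret M2: real_distribution M2 by fact
  define S where "S n = (\<Sum>k\<le>n. (\<i> * t) ^ k / fact k * (\<integral>x. x ^ k \<partial>M1))" for n
  have bound: "cmod (char N t - S n) \<le> 2 * (\<bar>t\<bar> * K) ^ n / fact n"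
    if N: "real_distribution N" "AE x in N. \<bar>x\<bar> \<le> K"
      "\<And>k. (\<integral>x. x ^ k \<partial>N) = (\<integral>x. x ^ k \<partial>M1)" for N n
  proof -
    interpret N: real_distribution N by fact
    have "cmod (char N t - S n) \<le> 2 * \<bar>t\<bar> ^ n / fact n * N.expectation (\<lambda>x. \<bar>x\<bar> ^ n)"
      using N.char_approx1[of n t] N.moment_support_bound(1)[OF N(2)] by (simp add: S_def N(3))
    also have "\<dots> \<le> 2 * \<bar>t\<bar> ^ n / fact n * K ^ n"
      by (intro mult_left_mono N.moment_support_bound N) auto
    finally show ?thesis by (simp add: power_mult_distrib)
  qed
  have lim: "(\<lambda>n. 2 * (\<bar>t\<bar> * K) ^ n / fact n) \<longlonglongrightarrow> 0"
    using tendsto_mult_left[OF summable_LIMSEQ_zero[OF summable_exp], of 2 "\<bar>t\<bar> * K"] by (simp add: field_simps)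
  have "S \<longlonglongrightarrow> char N t"
    if "real_distribution N" "AE x in N. \<bar>x\<bar> \<le> K"
      "\<And>k. (\<integral>x. x ^ k \<partial>N) = (\<integral>x. x ^ k \<partial>M1)" for N
  proof (rule LIM_zero_cancel, rule Lim_null_comparison[OF _ lim], rule always_eventually, rule allI)
    show "norm (S n - char N t) \<le> 2 * (\<bar>t\<bar> * K) ^ n / fact n" for n
      using bound[OF that, of n] by (simp add: norm_minus_commute)
  qed
  from this[of M1] this[of M2] show "char M1 t = char M2 t"
    using assms by (auto intro: LIMSEQ_unique)
qed

section \<open>The moments as averages over the circle\<close>

lemma integral_cis_int:
  "integral {-pi..pi} (\<lambda>x. cis (of_int m * x)) = (if m = 0 then 2 * of_real pi else 0)"
proof (cases "m = 0")
  case False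
  have "((\<lambda>x. cis (of_int m * x) / (\<i> * of_int m)) has_vector_derivative cis (of_int m * x))
      (at x within S)" for x S
    unfolding cis_conv_exp of_real_mult of_real_of_int_eq
    using False by (auto simp: mult_ac intro!: has_vector_derivative_real_field derivative_eq_intros)
  then have "((\<lambda>x. cis (of_int m * x)) has_integral
      (cis (of_int m * pi) / (\<i> * of_int m) - cis (of_int m * - pi) / (\<i> * of_int m))) {-pi..pi}"
    by (intro fundamental_theorem_of_calculus) auto
  moreover have "cis (of_int m * pi) = cis (of_int m * - pi)"
    by (auto simp: complex_eq_iff sin_times_pi_eq_0)
  ultimately show ?thesis
    using False by (auto dest: integral_unique)
qed (simp add: scaleR_conv_of_real)

lemma integral_trig_sum:
  fixes c :: "'i \<Rightarrow> complex"
  assumes "finite I"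
  shows "integral {-pi..pi} (\<lambda>x. \<Sum>i\<in>I. c i * cis (of_int (m i) * x)) =
    (\<Sum>i\<in>I. c i * (2 * of_real pi * of_bool (m i = 0)))"
proof -
  have "integral {-pi..pi} (\<lambda>x. \<Sum>i\<in>I. c i * cis (of_int (m i) * x)) =
      (\<Sum>i\<in>I. integral {-pi..pi} (\<lambda>x. c i * cis (of_int (m i) * x)))"
    by (intro integral_sum assms integrable_continuous_interval continuous_intros)
  then show ?thesis
    by (auto simp: integral_cis_int intro!: sum.cong)
qed

text \<open>The summands are the powers of a root of unity \<open>w\<close> with
  \<open>w ^ p = 1\<close>. Unless \<open>w = 1\<close>, which happens exactly when \<open>p\<close>
  divides \<open>m\<close>, the geometric sum vanishes.\<close>

lemma sum_cis_root_of_unity: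
  assumes "p > 0"
  shows "(\<Sum>l<p. cis (2 * pi * of_int m * real l / real p)) = of_nat p * of_bool (int p dvd m)"
proof -
  define w where "w = cis (2 * pi * of_int m / real p)"
  have *: "cis (2 * pi * of_int m * real l / real p) = w ^ l" for l
    unfolding w_def Complex.DeMoivre by (rule arg_cong[of _ _ cis]) (simp add: field_simps)
  show ?thesis
  proof (cases "int p dvd m")
    case True
    then obtain n where "m = int p * n" by auto
    then have "w = 1"
      using assms cis_multiple_2pi[of "of_int n"] by (simp add: w_def field_simps)
    then show ?thesis using True by (simp add: *)
  next
    case False
    have "w \<noteq> 1"
    proof
      assume "w = 1"
      then have "cos (2 * pi * of_int m / real p) = 1"
        by (simp add: w_def complex_eq_iff)
      then obtain n :: int where "2 * pi * of_int m / real p = of_int n * 2 * pi"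
        by (auto simp: cos_one_2pi_int)
      then have "real_of_int m = real_of_int (int p * n)"
        using assms by (simp add: field_simps)
      then show False using False by (simp only: of_int_eq_iff) auto
    qed
    moreover have "w ^ p = 1"
      using assms by (simp add: w_def Complex.DeMoivre complex_eq_iff)
    ultimately show ?thesis using False by (simp add: * geometric_sum)
  qed
qed

text \<open>Later arguments use only that the frequencies are integers and that there are finitely
  many. In the construction, \<open>h\<close> chooses in each of \<open>k\<close> factors one term
  of \<open>1 + cis u + cis v\<close> and one of its conjugate. Of the nine choices three cancel and
  six are the steps of the triangular lattice, so \<open>(M h, N h)\<close> is the displacement of a
  walk of \<open>k\<close> steps, loops of weight 3 included.\<close>

lemma norm_trig_sum_power_expansion:
  obtains I :: "(nat \<Rightarrow> (int \<times> int) \<times> (int \<times> int)) set" and M N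
  where "finite I"
    and "\<And>u v. of_real (norm (1 + cis u + cis v) ^ (2 * k)) =
      (\<Sum>h\<in>I. cis (of_int (M h) * u + of_int (N h) * v))"
proof -
  define E :: "(int \<times> int) set" where "E = {(0, 0), (1, 0), (0, 1)}"
  define d where "d u v e = of_int (fst (fst e) - fst (snd e)) * u + of_int (snd (fst e) - snd (snd e)) * v"
    for u v :: real and e :: "(int \<times> int) \<times> (int \<times> int)"
  define I where "I = {..<k} \<rightarrow>\<^sub>E E \<times> E"
  define M where "M h = (\<Sum>i<k. fst (fst (h i)) - fst (snd (h i)))"
    for h :: "nat \<Rightarrow> (int \<times> int) \<times> (int \<times> int)"
  define N where "N h = (\<Sum>i<k. snd (fst (h i)) - snd (snd (h i)))"
    for h :: "nat \<Rightarrow> (int \<times> int) \<times> (int \<times> int)"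
  show thesis
  proof (rule that)
    show "finite I" by (auto simp: I_def E_def intro!: finite_PiE)
    fix u v
    let ?w = "1 + cis u + cis v"
    have w: "?w = (\<Sum>e\<in>E. cis (of_int (fst e) * u + of_int (snd e) * v))"
      by (simp add: E_def)
    have "complex_of_real (norm ?w ^ (2 * k)) = (?w * cnj ?w) ^ k"
      by (simp only: of_real_power power_mult flip: complex_norm_square)
    also have "?w * cnj ?w = (\<Sum>e\<in>E \<times> E. cis (d u v e))"
      unfolding w cnj_sum sum_product sum.cartesian_product cis_cnj cis_mult
      by (auto simp: d_def algebra_simps intro!: sum.cong arg_cong[of _ _ cis])
    also have "(\<Sum>e\<in>E \<times> E. cis (d u v e)) ^ k = (\<Prod>i<k. \<Sum>e\<in>E \<times> E. cis (d u v e))"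
      by simp
    also have "\<dots> = (\<Sum>h\<in>I. \<Prod>i<k. cis (d u v (h i)))"
      unfolding I_def by (rule prod_sum_PiE) (auto simp: E_def)
    also have "\<dots> = (\<Sum>h\<in>I. cis (\<Sum>i<k. d u v (h i)))"
      by (simp add: cis_conv_exp exp_sum sum_distrib_left)
    also have "\<dots> = (\<Sum>h\<in>I. cis (of_int (M h) * u + of_int (N h) * v))"
      by (simp add: d_def M_def N_def sum.distrib sum_distrib_right)
    finally show "of_real (norm ?w ^ (2 * k)) = (\<Sum>h\<in>I. cis (of_int (M h) * u + of_int (N h) * v))" .
  qed
qed

section \<open>Counting the frequencies that contribute to a moment\<close>

lemma has_sum_sum:
  fixes f :: "'a \<Rightarrow> 'b \<Rightarrow> 'c :: topological_comm_monoid_add"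
  assumes "\<And>i. i \<in> I \<Longrightarrow> (f i has_sum s i) A"
  shows "((\<lambda>x. \<Sum>i\<in>I. f i x) has_sum (\<Sum>i\<in>I. s i)) A"
  using assms by (induction I rule: infinite_finite_induct) (auto intro: has_sum_add)

text \<open>A monomial has the phase \<open>M h * x + N h * y - (M h + N h) * z\<close>. Integrating
  over \<open>x\<close> and \<open>y\<close> forces both frequencies to be 0; then the
  \<open>z\<close> frequency is 0 as well and gives the third factor \<open>2 * pi\<close>.\<close>

lemma triple_integral_trig_sum:
  assumes "finite I"
    and f: "\<And>u v. f u v = (\<Sum>h\<in>I. cis (of_int (M h) * u + of_int (N h) * v))"
  shows "integral {-pi..pi} (\<lambda>z. integral {-pi..pi} (\<lambda>y. integral {-pi..pi} (\<lambda>x. f (x - z) (y - z)))) =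
    (\<Sum>h\<in>I. (2 * of_real pi) ^ 3 * of_bool (M h = 0 \<and> N h = 0))"
proof -
  have "f (x - z) (y - z) =
      (\<Sum>h\<in>I. cis (of_int (N h) * y - of_int (M h + N h) * z) * cis (of_int (M h) * x))" for x y z
    by (auto simp: f cis_mult algebra_simps intro!: sum.cong arg_cong[of _ _ cis])
  \<comment> \<open>The right-hand side isolates the character in the next variable, so that
    \<open>integral_trig_sum\<close> applies again.\<close>
  then have "integral {-pi..pi} (\<lambda>x. f (x - z) (y - z)) =
      (\<Sum>h\<in>I. cis (of_int (- (M h + N h)) * z) * (2 * of_real pi * of_bool (M h = 0)) *
        cis (of_int (N h) * y))" for y z
    using assms(1) by (simp only: integral_trig_sum)
      (auto simp: cis_mult mult_ac algebra_simps intro!: sum.cong)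
  then have "integral {-pi..pi} (\<lambda>y. integral {-pi..pi} (\<lambda>x. f (x - z) (y - z))) =
      (\<Sum>h\<in>I. (2 * of_real pi * of_bool (M h = 0)) * (2 * of_real pi * of_bool (N h = 0)) *
        cis (of_int (- (M h + N h)) * z))" for z
    using assms(1) by (simp only: integral_trig_sum) (auto simp: mult_ac intro!: sum.cong)
  then show ?thesis
    using assms(1) by (simp only: integral_trig_sum)
      (auto simp: power3_eq_cube mult_ac intro!: sum.cong)
qed

text \<open>The factor with index \<open>j\<close> adds \<open>j * p\<close> to both frequencies. A
  monomial with \<open>M h = N h\<close> divisible by \<open>p\<close> therefore survives for
  exactly one \<open>j\<close>, and every other monomial for none.\<close>

lemma dual_nanotube_moment_diagonal:
  assumes "p > 0" "finite I"
    and expansion: "\<And>u v. of_real (norm (1 + cis u + cis v) ^ (2 * k)) =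
      (\<Sum>h\<in>I. cis (of_int (M h) * u + of_int (N h) * v))"
  shows "dual_nanotube_moment p p k = (\<Sum>h\<in>I. of_bool (M h = N h \<and> int p dvd M h))"
proof -
  let ?C = "(2 * of_real pi) ^ 3 :: complex"
  have shift: "norm (cis x + cis y + cis z) = norm (1 + cis (x - z) + cis (y - z))" for x y z
  proof -
    have "cis x + cis y + cis z = cis z * (1 + cis (x - z) + cis (y - z))"
      by (simp add: algebra_simps cis_mult)
    then show ?thesis by (simp add: norm_mult)
  qed
  have "integral {-pi..pi} (\<lambda>z. integral {-pi..pi} (\<lambda>y. integral {-pi..pi} (\<lambda>x.
          of_real (norm (cis x + cis y + cis z) ^ (2 * k)) *
          cis (real_of_int j * (real p * (x - z) + real p * (y - z)))))) =
      (\<Sum>h\<in>I. ?C * of_bool (M h + j * int p = 0 \<and> N h + j * int p = 0))" for j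
    unfolding shift expansion sum_distrib_right
    by (rule triple_integral_trig_sum[OF assms(2), where f = "\<lambda>u v. (\<Sum>h\<in>I.
          cis (of_int (M h) * u + of_int (N h) * v) * cis (real_of_int j * (real p * u + real p * v)))"])
       (auto simp: cis_mult algebra_simps intro!: sum.cong arg_cong[of _ _ cis])
  moreover have "((\<lambda>j. \<Sum>h\<in>I. ?C * of_bool (M h + j * int p = 0 \<and> N h + j * int p = 0)) has_sum
      (\<Sum>h\<in>I. ?C * of_bool (M h = N h \<and> int p dvd M h))) UNIV"
  proof (rule has_sum_sum)
    fix h
    show "((\<lambda>j. ?C * of_bool (M h + j * int p = 0 \<and> N h + j * int p = 0)) has_sum
        ?C * of_bool (M h = N h \<and> int p dvd M h)) UNIV"
    proof (cases "M h = N h \<and> int p dvd M h")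
      case True
      then obtain i where i: "M h = int p * i" "N h = int p * i" by (metis dvdE)
      have "int p * i + j * int p = 0 \<longleftrightarrow> j = - i" for j
      proof -
        have "int p * i + j * int p = int p * (i + j)" by (simp add: algebra_simps)
        then show ?thesis using assms(1) by auto
      qed
      then show ?thesis
        using True by (intro has_sum_finite_neutralI[of "{- i}"]) (auto simp: i)
    next
      case False
      have no: "\<not> (M h + j * int p = 0 \<and> N h + j * int p = 0)" for j
      proof
        assume *: "M h + j * int p = 0 \<and> N h + j * int p = 0"
        then have "M h = int p * (- j)" "M h = N h" by (auto simp: algebra_simps)
        with False show False by auto
      qed
      have "?C * of_bool (M h = N h \<and> int p dvd M h) = 0"
        using False by simp
      then show ?thesis
        by (simp only:, intro has_sum_0) (use no in simp)
    qed
  qed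
  ultimately show ?thesis
    by (simp add: dual_nanotube_moment_def infsumI flip: sum_distrib_left)
qed

text \<open>With \<open>u = s + t\<close> and \<open>v = s - t\<close> the frequency in
  \<open>t\<close> is \<open>M h - N h\<close>, so integration over \<open>t\<close> selects
  \<open>M h = N h\<close>. The frequency in \<open>s\<close> is then the even number
  \<open>2 * M h\<close>, which is why the points \<open>l * pi / p\<close> of a half circle suffice
  to test whether \<open>p\<close> divides \<open>M h\<close>.\<close>

lemma dual_nanotube_moment_eq_average:
  assumes "p > 0"
  shows "of_real (\<Sum>l<p. integral {-pi..pi} (\<lambda>t.
      (4 * (cos t)\<^sup>2 + 4 * nanotube_angle_cos p l * cos t + 1) ^ k)) =
    2 * of_real pi * of_nat p * dual_nanotube_moment p p k"
proof -
  obtain I :: "(nat \<Rightarrow> (int \<times> int) \<times> (int \<times> int)) set" and M N where I: "finite I"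
    and expansion: "\<And>u v. of_real (norm (1 + cis u + cis v) ^ (2 * k)) =
      (\<Sum>h\<in>I. cis (of_int (M h) * u + of_int (N h) * v))"
    using norm_trig_sum_power_expansion by blast
  have norm: "(norm (1 + cis (s + t) + cis (s - t)))\<^sup>2 = 4 * (cos t)\<^sup>2 + 4 * cos s * cos t + 1" for s t
  proof -
    have "1 + cis (s + t) + cis (s - t) = Complex (1 + 2 * cos s * cos t) (2 * sin s * cos t)"
      by (simp add: complex_eq_iff cos_add sin_add cos_diff sin_diff)
    then have "(norm (1 + cis (s + t) + cis (s - t)))\<^sup>2 = (1 + 2 * cos s * cos t)\<^sup>2 + (2 * sin s * cos t)\<^sup>2"
      by (simp add: cmod_power2)
    also have "\<dots> = 1 + 4 * cos s * cos t + 4 * (cos t)\<^sup>2 * ((cos s)\<^sup>2 + (sin s)\<^sup>2)"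
      by algebra
    finally show ?thesis by simp
  qed
  have *: "of_real (integral {-pi..pi} (\<lambda>t. (4 * (cos t)\<^sup>2 + 4 * cos s * cos t + 1) ^ k)) =
      (\<Sum>h\<in>I. cis (of_int (M h + N h) * s) * (2 * of_real pi * of_bool (M h - N h = 0)))" for s
  proof -
    have "of_real (integral {-pi..pi} (\<lambda>t. (4 * (cos t)\<^sup>2 + 4 * cos s * cos t + 1) ^ k)) =
        integral {-pi..pi} (\<lambda>t. complex_of_real ((4 * (cos t)\<^sup>2 + 4 * cos s * cos t + 1) ^ k))"
      by (intro integral_unique[symmetric] has_integral_of_real integrable_integral
            integrable_continuous_interval continuous_intros)
    also have "\<dots> = integral {-pi..pi} (\<lambda>t. \<Sum>h\<in>I. cis (of_int (M h + N h) * s) * cis (of_int (M h - N h) * t))"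
      unfolding norm[symmetric] power_mult[symmetric] expansion
      by (auto simp: cis_mult algebra_simps intro!: integral_cong sum.cong arg_cong[of _ _ cis])
    finally show ?thesis by (simp only: integral_trig_sum[OF I])
  qed
  have "of_real (\<Sum>l<p. integral {-pi..pi} (\<lambda>t.
      (4 * (cos t)\<^sup>2 + 4 * nanotube_angle_cos p l * cos t + 1) ^ k)) =
    (\<Sum>h\<in>I. \<Sum>l<p. cis (of_int (M h + N h) * (real l * pi / real p)) * (2 * of_real pi * of_bool (M h - N h = 0)))"
    unfolding of_real_sum nanotube_angle_cos_def * by (rule sum.swap)
  also have "\<dots> = (\<Sum>h\<in>I. 2 * of_real pi * of_nat p * of_bool (M h = N h \<and> int p dvd M h))"
  proof (intro sum.cong refl)
    fix h
    show "(\<Sum>l<p. cis (of_int (M h + N h) * (real l * pi / real p)) * (2 * of_real pi * of_bool (M h - N h = 0))) =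
        2 * of_real pi * of_nat p * of_bool (M h = N h \<and> int p dvd M h)"
      using sum_cis_root_of_unity[OF assms, of "M h"]
      by (cases "M h = N h") (simp_all add: mult_ac flip: sum_distrib_left sum_distrib_right)
  qed
  finally show ?thesis
    by (simp add: dual_nanotube_moment_diagonal[OF assms I expansion] flip: sum_distrib_left)
qed

section \<open>Densities on the quarter circle\<close>

text \<open>Tested against a Borel set \<open>A\<close>, this says that \<open>g\<close> carries
  \<open>c\<close> times Lebesgue measure on the interval to the measure with density
  \<open>h\<close> on the image.\<close>

lemma nn_integral_substitution_const:
  fixes g g' h :: "real \<Rightarrow> real"
  assumes h: "h \<in> borel_measurable borel" and g: "continuous_on UNIV g"
    and A: "A \<in> sets borel" and ab: "a \<le> b"
    and deriv: "\<And>v. (g has_real_derivative g' v) (at v)"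
    and g': "continuous_on {a..b} g'" "\<And>v. v \<in> {a..b} \<Longrightarrow> g' v \<ge> 0"
    and const: "\<And>v. v \<in> {a<..<b} \<Longrightarrow> h (g v) * g' v = c"
  shows "(\<integral>\<^sup>+x. ennreal (h x) * indicator {g a..g b} x * indicator A x \<partial>lborel) =
    ennreal c * emeasure lborel ({a<..<b} \<inter> g -` A)"
proof -
  have [measurable]: "h \<in> borel_measurable borel" "g \<in> borel_measurable borel" "A \<in> sets borel"
    using h A borel_measurable_continuous_onI[OF g] by auto
  have "(\<integral>\<^sup>+x. ennreal (h x) * indicator {g a..g b} x * indicator A x \<partial>lborel) =
      (\<integral>\<^sup>+x. ennreal (h x * indicator A x * indicator {g a..g b} x) \<partial>lborel)"
    by (intro nn_integral_cong) (auto split: split_indicator)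
  also have "\<dots> = (\<integral>\<^sup>+x. ennreal (h (g x) * indicator A (g x) * g' x * indicator {a..b} x) \<partial>lborel)"
    by (rule nn_integral_substitution[OF _ deriv g' ab]) (auto simp: set_borel_measurable_def)
  also have "\<dots> = (\<integral>\<^sup>+x. ennreal c * indicator ({a<..<b} \<inter> g -` A) x \<partial>lborel)"
  proof (intro nn_integral_cong_AE)
    \<comment> \<open>Constancy is assumed only inside the interval, because at an endpoint a
      denominator of \<open>h\<close> may vanish; the two endpoints form a null set.\<close>
    have "AE x in lborel. x \<noteq> a" "AE x in lborel. x \<noteq> b"
      by (rule AE_lborel_singleton)+
    then show "AE x in lborel. ennreal (h (g x) * indicator A (g x) * g' x * indicator {a..b} x) =
        ennreal c * indicator ({a<..<b} \<inter> g -` A) x"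
    proof eventually_elim
      case (elim x)
      then show ?case
        using const[of x] by (auto split: split_indicator)
    qed
  qed
  also have "\<dots> = ennreal c * emeasure lborel ({a<..<b} \<inter> g -` A)"
    by (intro nn_integral_cmult_indicator)
       (use measurable_sets[of g borel borel A] in \<open>auto\<close>)
  finally show ?thesis .
qed

text \<open>Reflecting \<open>v\<close> to \<open>- v\<close> reduces this to the increasing case,
  as Lebesgue measure is invariant under reflection.\<close>

lemma nn_integral_substitution_const_decreasing:
  fixes g g' h :: "real \<Rightarrow> real"
  assumes h: "h \<in> borel_measurable borel" and g: "continuous_on UNIV g"
    and A: "A \<in> sets borel" and ab: "a \<le> b"
    and deriv: "\<And>v. (g has_real_derivative g' v) (at v)"
    and g': "continuous_on {a..b} g'" "\<And>v. v \<in> {a..b} \<Longrightarrow> g' v \<le> 0"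
    and const: "\<And>v. v \<in> {a<..<b} \<Longrightarrow> h (g v) * - g' v = c"
  shows "(\<integral>\<^sup>+x. ennreal (h x) * indicator {g b..g a} x * indicator A x \<partial>lborel) =
    ennreal c * emeasure lborel ({a<..<b} \<inter> g -` A)"
proof -
  have [measurable]: "g \<in> borel_measurable borel" "A \<in> sets borel"
    using A borel_measurable_continuous_onI[OF g] by auto
  have *: "{a<..<b} \<inter> g -` A \<in> sets borel"
    using measurable_sets[of g borel borel A] by auto
  \<comment> \<open>The double negations present the bounds as the values of the reflected map at
    \<open>- b\<close> and \<open>- a\<close>, as the increasing case expects.\<close>
  have "(\<integral>\<^sup>+x. ennreal (h x) * indicator {g (- (- b))..g (- (- a))} x * indicator A x \<partial>lborel) =
      ennreal c * emeasure lborel ({- b<..<- a} \<inter> (\<lambda>v. g (- v)) -` A)"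
  proof (rule nn_integral_substitution_const[OF h _ A, where g' = "\<lambda>v. - g' (- v)"])
    show "continuous_on UNIV (\<lambda>v. g (- v))"
      by (intro continuous_on_compose2[OF g] continuous_intros) auto
    show "((\<lambda>v. g (- v)) has_real_derivative - g' (- v)) (at v)" for v
      using DERIV_chain'[OF DERIV_minus[OF DERIV_ident] deriv, of v] by simp
    show "continuous_on {- b..- a} (\<lambda>v. - g' (- v))"
      by (intro continuous_intros continuous_on_compose2[OF g'(1)]) auto
    show "v \<in> {- b..- a} \<Longrightarrow> 0 \<le> - g' (- v)" for v
      using g'(2)[of "- v"] by auto
    show "v \<in> {- b<..<- a} \<Longrightarrow> h (g (- v)) * - g' (- v) = c" for v
      using const[of "- v"] by auto
  qed (use ab in auto)
  also have "{- b<..<- a} \<inter> (\<lambda>v. g (- v)) -` A = uminus -` ({a<..<b} \<inter> g -` A) \<inter> space lborel"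
    by auto
  also have "emeasure lborel \<dots> = emeasure (distr lborel borel uminus) ({a<..<b} \<inter> g -` A)"
    using * by (subst emeasure_distr) auto
  also have "\<dots> = emeasure lborel ({a<..<b} \<inter> g -` A)"
    by (simp only: lborel_distr_uminus)
  finally show ?thesis by simp
qed

text \<open>
  The common form of the densities \<open>f\<^sub>j\<close> with \<open>a\<^sub>j\<close> replaced by \<open>a \<in> [-1, 1]\<close>;
  then \<open>f\<^sub>0\<close> is the sum of the cases \<open>a = 1\<close> and \<open>a = -1\<close>.
\<close>

definition arc_density :: "real \<Rightarrow> real \<Rightarrow> real" where
  "arc_density a x =
     (if a \<ge> 0 then
        indicator {1..<5 + 4 * a} x /
          (pi * sqrt ((4 - (- a + sqrt (a\<^sup>2 + x - 1))\<^sup>2) * (a\<^sup>2 + x - 1)))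
      else
        1 / (pi * sqrt (a\<^sup>2 + x - 1)) *
          (indicator {1 - a\<^sup>2<..<1} x / sqrt (4 - (a + sqrt (a\<^sup>2 + x - 1))\<^sup>2) +
           indicator {1 - a\<^sup>2<..<5 + 4 * a} x / sqrt (4 - (- a + sqrt (a\<^sup>2 + x - 1))\<^sup>2)))"

abbreviation (input) arc_map :: "real \<Rightarrow> real \<Rightarrow> real" where
  "arc_map a v \<equiv> 4 * (cos v)\<^sup>2 + 4 * a * cos v + 1"

section \<open>The monotone branches of the arc map and their densities\<close>

lemma measurable_arc_density [measurable]: "arc_density a \<in> borel_measurable borel"
  unfolding arc_density_def by (cases "a \<ge> 0") simp_all

lemma continuous_arc_map: "continuous_on S (arc_map a)"
  by (intro continuous_intros)

lemma has_derivative_arc_map: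
  "(arc_map a has_real_derivative - (4 * ((2 * cos v + a) * sin v))) (at v)"
  by (auto intro!: derivative_eq_intros simp: algebra_simps)

lemma sqrt_arc_map: "sqrt (a\<^sup>2 + arc_map a v - 1) = \<bar>2 * cos v + a\<bar>"
proof -
  have "a\<^sup>2 + arc_map a v - 1 = (2 * cos v + a)\<^sup>2"
    by (simp add: power2_eq_square algebra_simps)
  then show ?thesis by simp
qed

lemma sqrt_4_minus_cos: "0 \<le> sin v \<Longrightarrow> sqrt (4 - (2 * cos v)\<^sup>2) = 2 * sin v"
proof -
  assume "0 \<le> sin v"
  moreover have "4 - (2 * cos v)\<^sup>2 = (2 * sin v)\<^sup>2"
    by (simp add: power_mult_distrib sin_squared_eq)
  ultimately show ?thesis by (simp only: real_sqrt_abs)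
qed

text \<open>
  The contribution of the branch \<open>cos v = (- a + e * sqrt (a\<^sup>2 + x - 1)) / 2\<close>, \<open>e = \<plusminus>1\<close>, of the
  inverse of \<open>arc_map a\<close>.
\<close>

definition arc_branch :: "real \<Rightarrow> real \<Rightarrow> real \<Rightarrow> real" where
  "arc_branch e a x = 1 / (pi * sqrt (a\<^sup>2 + x - 1)) * (1 / sqrt (4 - (- a + e * sqrt (a\<^sup>2 + x - 1))\<^sup>2))"

lemma measurable_arc_branch [measurable]: "arc_branch e a \<in> borel_measurable borel"
  unfolding arc_branch_def by simp

text \<open>Here \<open>e\<close> is the sign of \<open>2 * cos v + a\<close>. The two roots in
  \<open>arc_branch\<close> become \<open>\<bar>2 * cos v + a\<bar>\<close> and
  \<open>2 * sin v\<close>; the derivative cancels both and leaves \<open>2 / pi\<close>, the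
  density of the uniform law on the quarter circle.\<close>

lemma arc_branch_arc_map:
  assumes "e * \<bar>2 * cos v + a\<bar> = 2 * cos v + a" "0 < sin v" "2 * cos v + a \<noteq> 0"
  shows "arc_branch e a (arc_map a v) * \<bar>- (4 * ((2 * cos v + a) * sin v))\<bar> = 2 / pi"
proof -
  have "\<bar>- (4 * ((2 * cos v + a) * sin v))\<bar> = 4 * (\<bar>2 * cos v + a\<bar> * sin v)"
    using assms(2) by (simp add: abs_mult)
  moreover have "arc_branch e a (arc_map a v) = 1 / (pi * \<bar>2 * cos v + a\<bar>) * (1 / (2 * sin v))"
    unfolding arc_branch_def sqrt_arc_map assms(1) using assms(2) sqrt_4_minus_cos[of v] by simp
  moreover have "\<bar>2 * cos v + a\<bar> > 0"
    using assms(3) by simp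
  ultimately show ?thesis
    using assms(2) by (simp only:) (simp add: divide_simps)
qed

text \<open>Where \<open>2 * cos v + a\<close> is nonnegative the derivative of
  \<open>arc_map a\<close> is at most 0 and the inverse is the branch with \<open>e = 1\<close>. The
  increasing counterpart below uses \<open>e = - 1\<close>.\<close>

lemma arc_branch_pushforward_decreasing:
  assumes A: "A \<in> sets borel" and ab: "0 \<le> \<alpha>" "\<alpha> \<le> \<beta>" "\<beta> \<le> pi"
    and pos: "\<And>v. v \<in> {\<alpha>..\<beta>} \<Longrightarrow> 2 * cos v + a \<ge> 0"
      "\<And>v. v \<in> {\<alpha><..<\<beta>} \<Longrightarrow> 2 * cos v + a \<noteq> 0"
  shows "(\<integral>\<^sup>+x. ennreal (arc_branch 1 a x) * indicator {arc_map a \<beta>..arc_map a \<alpha>} x * indicator A x \<partial>lborel) =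
    ennreal (2 / pi) * emeasure lborel ({\<alpha><..<\<beta>} \<inter> arc_map a -` A)"
proof (rule nn_integral_substitution_const_decreasing[OF _ continuous_arc_map A ab(2) has_derivative_arc_map])
  show "continuous_on {\<alpha>..\<beta>} (\<lambda>v. - (4 * ((2 * cos v + a) * sin v)))"
    by (intro continuous_intros)
  fix v assume v: "v \<in> {\<alpha>..\<beta>}"
  have "0 \<le> sin v"
    using v ab by (intro sin_ge_zero) auto
  then show "- (4 * ((2 * cos v + a) * sin v)) \<le> 0"
    using pos(1)[OF v] by (simp add: mult_nonneg_nonneg)
next
  fix v assume v: "v \<in> {\<alpha><..<\<beta>}"
  have "0 < sin v"
    using v ab by (intro sin_gt_zero) auto
  then show "arc_branch 1 a (arc_map a v) * - (- (4 * ((2 * cos v + a) * sin v))) = 2 / pi"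
    using arc_branch_arc_map[of 1 v a] pos(1)[of v] pos(2)[of v] v by (simp add: abs_mult)
qed simp

lemma arc_branch_pushforward_increasing:
  assumes A: "A \<in> sets borel" and ab: "0 \<le> \<alpha>" "\<alpha> \<le> \<beta>" "\<beta> \<le> pi"
    and neg: "\<And>v. v \<in> {\<alpha>..\<beta>} \<Longrightarrow> 2 * cos v + a \<le> 0"
      "\<And>v. v \<in> {\<alpha><..<\<beta>} \<Longrightarrow> 2 * cos v + a \<noteq> 0"
  shows "(\<integral>\<^sup>+x. ennreal (arc_branch (- 1) a x) * indicator {arc_map a \<alpha>..arc_map a \<beta>} x * indicator A x \<partial>lborel) =
    ennreal (2 / pi) * emeasure lborel ({\<alpha><..<\<beta>} \<inter> arc_map a -` A)"
proof (rule nn_integral_substitution_const[OF _ continuous_arc_map A ab(2) has_derivative_arc_map])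
  show "continuous_on {\<alpha>..\<beta>} (\<lambda>v. - (4 * ((2 * cos v + a) * sin v)))"
    by (intro continuous_intros)
  fix v assume v: "v \<in> {\<alpha>..\<beta>}"
  have "0 \<le> sin v"
    using v ab by (intro sin_ge_zero) auto
  then show "- (4 * ((2 * cos v + a) * sin v)) \<ge> 0"
    using neg(1)[OF v] by (simp add: mult_nonneg_nonpos mult.commute)
next
  fix v assume v: "v \<in> {\<alpha><..<\<beta>}"
  have "0 < sin v"
    using v ab by (intro sin_gt_zero) auto
  then show "arc_branch (- 1) a (arc_map a v) * (- (4 * ((2 * cos v + a) * sin v))) = 2 / pi"
  proof -
    have "2 * cos v + a < 0"
      using neg[of v] v by force
    then have "\<bar>- (4 * ((2 * cos v + a) * sin v))\<bar> = - (4 * ((2 * cos v + a) * sin v))"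
      using \<open>0 < sin v\<close> mult_neg_pos[of "2 * cos v + a" "sin v"] by (intro abs_of_nonneg) linarith
    then show ?thesis
      using arc_branch_arc_map[of "- 1" v a] \<open>0 < sin v\<close> \<open>2 * cos v + a < 0\<close> by simp
  qed
qed simp

text \<open>Since \<open>sqrt\<close> is negative on negative arguments, both radicands have to be
  controlled. Nonnegativity matters because \<open>ennreal\<close> truncates negative values and is
  additive only on nonnegative ones.\<close>

lemma arc_branch_nonneg:
  assumes "1 - a\<^sup>2 \<le> x" "\<bar>- a + e * sqrt (a\<^sup>2 + x - 1)\<bar> \<le> 2"
  shows "0 \<le> arc_branch e a x"
proof -
  have "(- a + e * sqrt (a\<^sup>2 + x - 1))\<^sup>2 \<le> 2\<^sup>2"
    using assms(2) by (subst abs_le_square_iff[symmetric]) auto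
  then show ?thesis
    using assms(1) by (auto simp: arc_branch_def)
qed

lemma arc_branch_upper_nonneg:
  assumes "\<bar>a\<bar> \<le> 1" "1 - a\<^sup>2 \<le> x" "x \<le> 5 + 4 * a"
  shows "0 \<le> arc_branch 1 a x"
proof (rule arc_branch_nonneg)
  \<comment> \<open>The bound \<open>5 + 4 * a\<close> is the value of \<open>arc_map a\<close> at
    0, where the root equals \<open>a + 2\<close>.\<close>
  have "a\<^sup>2 + x - 1 \<le> (a + 2)\<^sup>2"
    using assms by (simp add: power2_eq_square algebra_simps)
  then have "sqrt (a\<^sup>2 + x - 1) \<le> a + 2"
    using assms by (intro real_le_lsqrt) auto
  moreover have "0 \<le> sqrt (a\<^sup>2 + x - 1)"
    using assms by auto
  ultimately show "\<bar>- a + 1 * sqrt (a\<^sup>2 + x - 1)\<bar> \<le> 2"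
    using assms(1) by linarith
qed fact

lemma arc_branch_lower_nonneg:
  assumes "- 1 \<le> a" "a \<le> 0" "1 - a\<^sup>2 \<le> x" "x \<le> 1"
  shows "0 \<le> arc_branch (- 1) a x"
proof (rule arc_branch_nonneg)
  have "sqrt (a\<^sup>2 + x - 1) \<le> - a"
    using assms by (intro real_le_lsqrt) auto
  moreover have "0 \<le> sqrt (a\<^sup>2 + x - 1)"
    using assms by auto
  ultimately show "\<bar>- a + - 1 * sqrt (a\<^sup>2 + x - 1)\<bar> \<le> 2"
    using assms(1,2) by linarith
qed fact

lemma arc_density_eq_branches:
  "arc_density a x =
     (if a \<ge> 0 then arc_branch 1 a x * indicator {1..<5 + 4 * a} x
      else arc_branch (- 1) a x * indicator {1 - a\<^sup>2<..<1} x +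
        arc_branch 1 a x * indicator {1 - a\<^sup>2<..<5 + 4 * a} x)"
proof -
  have "(- a + - 1 * s)\<^sup>2 = (a + s)\<^sup>2" for s
    by (simp add: power2_eq_square algebra_simps)
  then show ?thesis
    unfolding arc_density_def arc_branch_def
    by (simp add: real_sqrt_mult mult_ac distrib_left)
qed

lemma arc_density_nonneg:
  assumes "\<bar>a\<bar> \<le> 1"
  shows "0 \<le> arc_density a x"
proof -
  have "1 - a\<^sup>2 \<le> 1" by simp
  then have "1 \<le> x \<Longrightarrow> 1 - a\<^sup>2 \<le> x" by linarith
  then show ?thesis
    using assms unfolding arc_density_eq_branches
    by (auto intro!: add_nonneg_nonneg arc_branch_upper_nonneg arc_branch_lower_nonneg
        split: split_indicator)
qed

lemma arc_density_support:
  assumes "\<bar>a\<bar> \<le> 1" "x \<notin> {0..9}"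
  shows "arc_density a x = 0"
proof -
  have "a\<^sup>2 \<le> 1" using assms(1) abs_square_le_1 by blast
  then show ?thesis
    using assms unfolding arc_density_eq_branches by (auto split: split_indicator)
qed

text \<open>For \<open>a \<ge> 0\<close> the map decreases on the whole quarter circle, from
  \<open>5 + 4 * a\<close> to 1. For \<open>a < 0\<close> it first decreases to its minimum
  \<open>1 - a\<^sup>2\<close> and then increases to 1, and each monotone piece contributes one
  branch. Endpoints of the indicators are ignored as null sets.\<close>

lemma emeasure_arc_density:
  assumes a: "\<bar>a\<bar> \<le> 1" and A [measurable]: "A \<in> sets borel"
  shows "(\<integral>\<^sup>+x. ennreal (arc_density a x) * indicator A x \<partial>lborel) =
    ennreal (2 / pi) * emeasure lborel ({0<..<pi / 2} \<inter> arc_map a -` A)"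
proof (cases "a \<ge> 0")
  case True
  have cos: "0 < cos v" if "v \<in> {0<..<pi / 2}" for v
    using that by (intro cos_gt_zero) auto
  have cos': "0 \<le> cos v" if "v \<in> {0..pi / 2}" for v
    using that by (intro cos_ge_zero) auto
  have "(\<integral>\<^sup>+x. ennreal (arc_density a x) * indicator A x \<partial>lborel) =
      (\<integral>\<^sup>+x. ennreal (arc_branch 1 a x) * indicator {arc_map a (pi / 2)..arc_map a 0} x * indicator A x \<partial>lborel)"
  proof (intro nn_integral_cong_AE)
    have "AE x in lborel. x \<noteq> 5 + 4 * a"
      by (rule AE_lborel_singleton)
    then show "AE x in lborel. ennreal (arc_density a x) * indicator A x =
        ennreal (arc_branch 1 a x) * indicator {arc_map a (pi / 2)..arc_map a 0} x * indicator A x"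
    proof eventually_elim
      case (elim x)
      then show ?case
        using True by (auto simp: arc_density_eq_branches split: split_indicator)
    qed
  qed
  also have "\<dots> = ennreal (2 / pi) * emeasure lborel ({0<..<pi / 2} \<inter> arc_map a -` A)"
    using True cos cos'
    by (intro arc_branch_pushforward_decreasing A) (auto intro!: add_nonneg_nonneg simp: add_pos_nonneg less_imp_neq[symmetric])
  finally show ?thesis .
next
  case False
  \<comment> \<open>The turning point, where the factor \<open>2 * cos v + a\<close> of the
    derivative vanishes.\<close>
  define \<alpha> where "\<alpha> = arccos (- a / 2)"
  have cos_\<alpha>: "cos \<alpha> = - a / 2"
    unfolding \<alpha>_def using a False by (intro cos_arccos) auto
  have \<alpha>: "0 < \<alpha>" "\<alpha> < pi / 2"
    using arccos_less_arccos[of "- a / 2" 1] arccos_less_arccos[of 0 "- a / 2"] a False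
    by (auto simp: \<alpha>_def)
  have left: "2 * cos v + a > 0" if "v \<in> {0..<\<alpha>}" for v
    using cos_monotone_0_pi[of v \<alpha>] that \<alpha> pi_gt_zero by (auto simp: cos_\<alpha> simp del: pi_gt_zero)
  have right: "2 * cos v + a < 0" if "v \<in> {\<alpha><..pi / 2}" for v
    using cos_monotone_0_pi[of \<alpha> v] that \<alpha> pi_gt_zero by (auto simp: cos_\<alpha> simp del: pi_gt_zero)
  have map_\<alpha>: "arc_map a \<alpha> = 1 - a\<^sup>2"
    by (simp add: cos_\<alpha> power2_eq_square)
  have [measurable]: "arc_map a -` A \<in> sets borel"
    using measurable_sets[OF borel_measurable_continuous_onI[OF continuous_arc_map] A] by simp
  have "(\<integral>\<^sup>+x. ennreal (arc_density a x) * indicator A x \<partial>lborel) =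
      (\<integral>\<^sup>+x. ennreal (arc_branch (- 1) a x) * indicator {arc_map a \<alpha>..arc_map a (pi / 2)} x * indicator A x +
        ennreal (arc_branch 1 a x) * indicator {arc_map a \<alpha>..arc_map a 0} x * indicator A x \<partial>lborel)"
  proof (intro nn_integral_cong_AE)
    have "AE x in lborel. x \<noteq> 5 + 4 * a" "AE x in lborel. x \<noteq> 1" "AE x in lborel. x \<noteq> 1 - a\<^sup>2"
      by (rule AE_lborel_singleton)+
    then show "AE x in lborel. ennreal (arc_density a x) * indicator A x =
        ennreal (arc_branch (- 1) a x) * indicator {arc_map a \<alpha>..arc_map a (pi / 2)} x * indicator A x +
        ennreal (arc_branch 1 a x) * indicator {arc_map a \<alpha>..arc_map a 0} x * indicator A x"
    proof eventually_elim
      case (elim x)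
      \<comment> \<open>Both branches are present below 1, so nonnegativity is used to split
        \<open>ennreal\<close> of their sum.\<close>
      have "0 \<le> arc_branch (- 1) a x" if "1 - a\<^sup>2 \<le> x" "x \<le> 1"
        using that a False by (intro arc_branch_lower_nonneg) auto
      moreover have "0 \<le> arc_branch 1 a x" if "1 - a\<^sup>2 \<le> x" "x \<le> 5 + 4 * a"
        using that a False by (intro arc_branch_upper_nonneg) auto
      ultimately show ?case
        unfolding map_\<alpha> using False elim
        by (auto simp: arc_density_eq_branches split: split_indicator)
    qed
  qed
  also have "\<dots> = ennreal (2 / pi) * emeasure lborel ({\<alpha><..<pi / 2} \<inter> arc_map a -` A) +
      ennreal (2 / pi) * emeasure lborel ({0<..<\<alpha>} \<inter> arc_map a -` A)"
  proof (subst nn_integral_add, goal_cases)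
    case 3
    have 1: "2 * cos v + a \<ge> 0" if "v \<in> {0..\<alpha>}" for v
      using left[of v] that by (cases "v = \<alpha>") (auto simp: cos_\<alpha>)
    have 2: "2 * cos v + a \<le> 0" if "v \<in> {\<alpha>..pi / 2}" for v
      using right[of v] that by (cases "v = \<alpha>") (auto simp: cos_\<alpha>)
    have 3: "2 * cos v + a \<noteq> 0" if "v \<in> {0<..<\<alpha>} \<or> v \<in> {\<alpha><..<pi / 2}" for v
      using left[of v] right[of v] that by auto
    show ?case
      using \<alpha> 3
      by (intro arg_cong2[of _ _ _ _ "(+)"] arc_branch_pushforward_increasing
            arc_branch_pushforward_decreasing A 1 2) auto
  qed simp_all
  also have "\<dots> = ennreal (2 / pi) * (emeasure lborel ({\<alpha><..<pi / 2} \<inter> arc_map a -` A) +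
      emeasure lborel ({0<..<\<alpha>} \<inter> arc_map a -` A))"
    by (simp add: distrib_left)
  also have "emeasure lborel ({\<alpha><..<pi / 2} \<inter> arc_map a -` A) +
      emeasure lborel ({0<..<\<alpha>} \<inter> arc_map a -` A) =
      emeasure lborel (({\<alpha><..<pi / 2} \<inter> arc_map a -` A) \<union> ({0<..<\<alpha>} \<inter> arc_map a -` A))"
    by (rule plus_emeasure) auto
  \<comment> \<open>At most the turning point is missing from the union, which does not affect the
    measure.\<close>
  also have "({\<alpha><..<pi / 2} \<inter> arc_map a -` A) \<union> ({0<..<\<alpha>} \<inter> arc_map a -` A) =
      ({0<..<pi / 2} \<inter> arc_map a -` A) - {\<alpha>}"
    using \<alpha> by auto
  also have "emeasure lborel \<dots> = emeasure lborel ({0<..<pi / 2} \<inter> arc_map a -` A)"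
    by (rule emeasure_Diff_null_set) auto
  finally show ?thesis .
qed

lemma distributed_arc_map:
  assumes "\<bar>a\<bar> \<le> 1"
  shows "distributed (uniform_measure lborel {0<..<pi / 2}) lborel (arc_map a) (\<lambda>x. ennreal (arc_density a x))"
  unfolding distributed_def
proof (intro conjI measure_eqI)
  show meas: "arc_map a \<in> uniform_measure lborel {0<..<pi / 2} \<rightarrow>\<^sub>M lborel"
    using borel_measurable_continuous_onI[OF continuous_arc_map] by simp
  fix A assume "A \<in> sets (distr (uniform_measure lborel {0<..<pi / 2}) lborel (arc_map a))"
  then have A: "A \<in> sets borel" by simp
  then have A': "arc_map a -` A \<in> sets borel"
    using measurable_sets[OF borel_measurable_continuous_onI[OF continuous_arc_map]] by simp
  have "emeasure (distr (uniform_measure lborel {0<..<pi / 2}) lborel (arc_map a)) A =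
      emeasure lborel ({0<..<pi / 2} \<inter> arc_map a -` A) / ennreal (pi / 2)"
    using A A' by (subst emeasure_distr[OF meas]) (auto simp: emeasure_uniform_measure)
  also have "\<dots> = ennreal (2 / pi) * emeasure lborel ({0<..<pi / 2} \<inter> arc_map a -` A)"
    by (simp add: divide_ennreal_def inverse_ennreal mult.commute)
  finally show "emeasure (distr (uniform_measure lborel {0<..<pi / 2}) lborel (arc_map a)) A =
      emeasure (density lborel (\<lambda>x. ennreal (arc_density a x))) A"
    using A by (simp add: emeasure_density emeasure_arc_density[OF assms])
qed simp_all

section \<open>The law of the dual armchair nanotube\<close>

text \<open>The two definitions differ only in the case condition, and monotonicity of the cosine on
  the half circle shows that \<open>2 * j \<le> p\<close> is the condition that the cosine is
  nonnegative.\<close>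

lemma dual_armchair_f_eq:
  assumes "0 < j" "j < p"
  shows "dual_armchair_f p j = arc_density (nanotube_angle_cos p j)"
proof -
  have "2 * j \<le> p \<longleftrightarrow> 0 \<le> nanotube_angle_cos p j"
  proof (cases "2 * j \<le> p")
    case True
    then have "2 * real j \<le> real p"
      by (metis of_nat_le_iff of_nat_mult of_nat_numeral)
    then have "real j * pi / real p \<le> pi / 2"
      using assms by (simp add: field_simps)
    moreover have "0 \<le> real j * pi / real p" by simp
    ultimately have "0 \<le> cos (real j * pi / real p)"
      using pi_gt_zero by (intro cos_ge_zero) linarith+
    then show ?thesis using True by (simp add: nanotube_angle_cos_def)
  next
    case False
    then have "real p < 2 * real j"
      by (metis not_le of_nat_less_iff of_nat_mult of_nat_numeral)
    then have "cos (real j * pi / real p) < cos (pi / 2)"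
      using assms by (intro cos_monotone_0_pi) (auto simp: field_simps)
    then show ?thesis using False by (simp add: nanotube_angle_cos_def)
  qed
  then show ?thesis
    by (simp add: fun_eq_iff dual_armchair_f_def arc_density_def Let_def)
qed

text \<open>For \<open>a = 1\<close> and \<open>a = - 1\<close> the radicand
  \<open>a\<^sup>2 + x - 1\<close> is \<open>x\<close>. The first summand of
  \<open>dual_armchair_f0\<close> is cut at 1: above it comes from \<open>a = 1\<close>, below it
  from the lower branch for \<open>a = - 1\<close>. The second summand is the upper branch for
  \<open>a = - 1\<close>.\<close>

lemma dual_armchair_f0_eq: "dual_armchair_f0 x = arc_density 1 x + arc_density (- 1) x"
proof -
  have sq: "4 - (1 - sqrt x)\<^sup>2 = 3 + 2 * sqrt x - x" "4 - (- 1 + sqrt x)\<^sup>2 = 3 + 2 * sqrt x - x"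
    "4 - (1 + sqrt x)\<^sup>2 = 3 - 2 * sqrt x - x" if "0 \<le> x" for x :: real
    using that by (simp_all add: power2_eq_square algebra_simps)
  consider "x \<le> 0" | "0 < x" "x < 1" | "x \<ge> 1" by linarith
  then show ?thesis
  proof cases
    case 2
    have "1 / (pi * sqrt (x * (3 + 2 * sqrt x - x))) = 1 / (pi * sqrt x) * (1 / sqrt (4 - (1 - sqrt x)\<^sup>2))"
      "1 / (pi * sqrt (x * (3 - 2 * sqrt x - x))) = 1 / (pi * sqrt x) * (1 / sqrt (4 - (1 + sqrt x)\<^sup>2))"
      using 2 by (simp_all add: sq real_sqrt_mult)
    with 2 show ?thesis
      by (simp add: dual_armchair_f0_def arc_density_eq_branches arc_branch_def algebra_simps)
  next
    case 3
    then show ?thesis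
      using sq[of x] by (simp add: dual_armchair_f0_def arc_density_def mult.commute split: split_indicator)
  qed (simp add: dual_armchair_f0_def arc_density_def)
qed

section \<open>Symmetries of the angles and moments of the arc laws\<close>

lemma abs_nanotube_angle_cos_le_one: "\<bar>nanotube_angle_cos p j\<bar> \<le> 1"
  by (simp add: nanotube_angle_cos_def)

lemma nanotube_angle_cos_reflect: "0 < p \<Longrightarrow> j \<le> p \<Longrightarrow> nanotube_angle_cos p (p - j) = - nanotube_angle_cos p j"
  by (simp add: nanotube_angle_cos_def of_nat_diff left_diff_distrib diff_divide_distrib)

text \<open>Links expectations, which are Bochner integrals, with the gauge integral
  \<open>integral\<close> of the moment formula.\<close>

lemma integral_quarter_circle_uniform:
  fixes \<phi> :: "real \<Rightarrow> real"
  assumes "continuous_on UNIV \<phi>"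
  shows "(\<integral>v. \<phi> v \<partial>uniform_measure lborel {0<..<pi / 2}) = 2 / pi * integral {0..pi / 2} \<phi>"
    and "integrable (uniform_measure lborel {0<..<pi / 2}) \<phi>"
proof -
  have [measurable]: "\<phi> \<in> borel_measurable borel"
    by (rule borel_measurable_continuous_onI[OF assms])
  have dens: "uniform_measure lborel {0<..<pi / 2} =
      density lborel (\<lambda>v. ennreal (2 / pi * indicator {0<..<pi / 2} v))"
    unfolding uniform_measure_def
    by (intro density_cong AE_I2) (auto simp: inverse_ennreal divide_ennreal_def split: split_indicator)
  have "set_integrable lborel {0..pi / 2} \<phi>"
    by (intro borel_integrable_atLeastAtMost' continuous_on_subset[OF assms]) auto
  then have int: "set_integrable lborel {0<..<pi / 2} \<phi>"
    by (rule set_integrable_subset) auto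
  have "(\<integral>v. \<phi> v \<partial>uniform_measure lborel {0<..<pi / 2}) = 2 / pi * (LINT v:{0<..<pi / 2}|lborel. \<phi> v)"
    unfolding dens set_lebesgue_integral_def by (subst integral_real_density)
       (simp_all only: mult.assoc integral_mult_right_zero real_scaleR_def, simp_all)
  also have "(LINT v:{0<..<pi / 2}|lborel. \<phi> v) = integral {0..pi / 2} \<phi>"
    by (simp add: set_borel_integral_eq_integral[OF int] integral_open_interval_real)
  finally show "(\<integral>v. \<phi> v \<partial>uniform_measure lborel {0<..<pi / 2}) = 2 / pi * integral {0..pi / 2} \<phi>" .
  show "integrable (uniform_measure lborel {0<..<pi / 2}) \<phi>"
    using integrable_mult_right[OF int[unfolded set_integrable_def], of "2 / pi"]
    unfolding dens by (subst integrable_real_density) (auto simp: mult_ac)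
qed

text \<open>Evenness folds the circle onto \<open>{0..pi}\<close>, and \<open>v\<close> to
  \<open>pi - v\<close> folds the second half of that interval onto the first.\<close>

lemma integral_full_circle:
  fixes f :: "real \<Rightarrow> real"
  assumes "continuous_on UNIV f" and even: "\<And>v. f (- v) = f v"
  shows "integral {-pi..pi} f = 2 * (integral {0..pi / 2} f + integral {0..pi / 2} (\<lambda>v. f (pi - v)))"
proof -
  have int: "f integrable_on {a..b}" for a b
    by (intro integrable_continuous_interval continuous_on_subset[OF assms(1)]) auto
  have "integral {-pi..pi} f = integral {-pi..- 0} f + integral {0..pi} f"
    using Henstock_Kurzweil_Integration.integral_combine[of "- pi" 0 pi f] int by simp
  also have "integral {-pi..- 0} f = integral {0..pi} f"
    using Henstock_Kurzweil_Integration.integral_reflect_real[of pi 0 f] by (simp only: even)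
  also have "integral {0..pi} f = integral {0..pi / 2} f + integral {pi / 2..pi} f"
    using Henstock_Kurzweil_Integration.integral_combine[of 0 "pi / 2" pi f] int by simp
  also have "integral {pi / 2..pi} f = integral {- (pi / 2)..- 0} (\<lambda>v. f (v + pi))"
    using integral_shift_real_ivl[of "pi / 2" pi pi f] by simp
  also have "\<dots> = integral {0..pi / 2} (\<lambda>v. f (pi - v))"
    using Henstock_Kurzweil_Integration.integral_reflect_real[of "pi / 2" 0 "\<lambda>v. f (pi - v)"] by (simp add: add.commute)
  finally show ?thesis by simp
qed

definition arc_moment :: "real \<Rightarrow> nat \<Rightarrow> real" where
  "arc_moment a k = (\<integral>v. arc_map a v ^ k \<partial>uniform_measure lborel {0<..<pi / 2})"

text \<open>Passing from \<open>v\<close> to \<open>pi - v\<close> changes the sign of the cosine,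
  which amounts to replacing \<open>a\<close> by \<open>- a\<close>.\<close>

lemma arc_moment_symmetric:
  "integral {-pi..pi} (\<lambda>v. arc_map a v ^ k) = pi * (arc_moment a k + arc_moment (- a) k)"
proof -
  have cont: "continuous_on UNIV (\<lambda>v. arc_map a v ^ k)" for a
    by (intro continuous_intros)
  have "integral {-pi..pi} (\<lambda>v. arc_map a v ^ k) =
      2 * (integral {0..pi / 2} (\<lambda>v. arc_map a v ^ k) + integral {0..pi / 2} (\<lambda>v. arc_map (- a) v ^ k))"
    by (subst integral_full_circle[OF cont]) simp_all
  then show ?thesis
    unfolding arc_moment_def integral_quarter_circle_uniform(1)[OF cont]
    by (simp add: field_simps)
qed

lemma has_bochner_integral_arc_density:
  assumes "\<bar>a\<bar> \<le> 1"
  shows "has_bochner_integral lborel (\<lambda>x. arc_density a x * x ^ k) (arc_moment a k)"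
proof -
  have cont: "continuous_on UNIV (\<lambda>v. arc_map a v ^ k)"
    by (intro continuous_intros)
  have "integrable lborel (\<lambda>x. arc_density a x * x ^ k)"
    using integral_quarter_circle_uniform(2)[OF cont]
    by (subst distributed_integrable[OF distributed_arc_map[OF assms]])
       (auto simp: arc_density_nonneg[OF assms])
  moreover have "(\<integral>x. arc_density a x * x ^ k \<partial>lborel) = arc_moment a k"
    unfolding arc_moment_def
    by (subst distributed_integral[OF distributed_arc_map[OF assms]])
       (auto simp: arc_density_nonneg[OF assms])
  ultimately show ?thesis by (simp add: has_bochner_integral_iff)
qed

section \<open>The mixture density and its moments\<close>

lemma dual_armchair_density_eq:
  assumes "p \<ge> 2"
  shows "dual_armchair_density p x = 1 / real p * (1 / 2 * (arc_density 1 x + arc_density (- 1) x) +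
    (\<Sum>j = 1..p - 1. arc_density (nanotube_angle_cos p j) x))"
proof -
  have "(\<Sum>j = 1..p - 1. dual_armchair_f p j x) = (\<Sum>j = 1..p - 1. arc_density (nanotube_angle_cos p j) x)"
    using assms by (intro sum.cong) (auto simp: dual_armchair_f_eq)
  then show ?thesis by (simp add: dual_armchair_density_def dual_armchair_f0_eq)
qed

lemma has_bochner_integral_dual_armchair_density:
  assumes "p \<ge> 2"
  shows "has_bochner_integral lborel (\<lambda>x. dual_armchair_density p x * x ^ k)
    (1 / real p * (1 / 2 * (arc_moment 1 k + arc_moment (- 1) k) +
      (\<Sum>j = 1..p - 1. arc_moment (nanotube_angle_cos p j) k)))"
proof -
  have "has_bochner_integral lborel (\<lambda>x. 1 / real p * (1 / 2 * (arc_density 1 x * x ^ k + arc_density (- 1) x * x ^ k) +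
      (\<Sum>j = 1..p - 1. arc_density (nanotube_angle_cos p j) x * x ^ k)))
    (1 / real p * (1 / 2 * (arc_moment 1 k + arc_moment (- 1) k) +
      (\<Sum>j = 1..p - 1. arc_moment (nanotube_angle_cos p j) k)))"
    by (intro has_bochner_integral_mult_right has_bochner_integral_add has_bochner_integral_sum
        has_bochner_integral_arc_density abs_nanotube_angle_cos_le_one) auto
  then show ?thesis
    by (simp add: dual_armchair_density_eq[OF assms] algebra_simps sum_distrib_left)
qed

text \<open>Each \<open>l\<close> in the average contributes the moments for \<open>a\<close> and
  \<open>- a\<close>. For \<open>l = 0\<close> these are the cases 1 and -1, each occurring once.
  For the others, exchanging \<open>j\<close> and \<open>p - j\<close> changes the sign of the
  cosine, so every moment occurs twice; this explains the relative weight 1/2 of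
  \<open>dual_armchair_f0\<close>.\<close>

lemma dual_armchair_density_moment:
  assumes "p \<ge> 2"
  shows "complex_of_real (\<integral>x. dual_armchair_density p x * x ^ k \<partial>lborel) = dual_nanotube_moment p p k"
proof -
  let ?m = "\<lambda>j. arc_moment (nanotube_angle_cos p j) k"
  let ?m' = "\<lambda>j. arc_moment (- nanotube_angle_cos p j) k"
  \<comment> \<open>The upper expression \<open>p - 1 + 1 - j\<close> is the form in which
    \<open>sum.atLeastAtMost_rev\<close> reverses the range; it equals \<open>p - j\<close>.\<close>
  have "(\<Sum>j = 1..p - 1. ?m j) = (\<Sum>j = 1..p - 1. ?m (p - 1 + 1 - j))"
    by (subst sum.atLeastAtMost_rev) (simp add: add.commute)
  also have "\<dots> = (\<Sum>j = 1..p - 1. ?m' j)"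
  proof (intro sum.cong refl)
    fix j assume "j \<in> {1..p - 1}"
    then have "p - 1 + 1 - j = p - j" "j \<le> p" "0 < p" by auto
    then show "?m (p - 1 + 1 - j) = ?m' j"
      by (simp only: nanotube_angle_cos_reflect)
  qed
  finally have sym: "(\<Sum>j = 1..p - 1. ?m j) = (\<Sum>j = 1..p - 1. ?m' j)" .
  have "{..<p} = insert 0 {1..p - 1}"
    using assms by auto
  then have "(\<Sum>l<p. ?m l + ?m' l) = arc_moment 1 k + arc_moment (- 1) k + (\<Sum>j = 1..p - 1. ?m j + ?m' j)"
    by (simp add: nanotube_angle_cos_def)
  also have "\<dots> = 2 * real p * (\<integral>x. dual_armchair_density p x * x ^ k \<partial>lborel)"
    using assms has_bochner_integral_integral_eq[OF has_bochner_integral_dual_armchair_density[OF assms]]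
    by (simp only: sum.distrib sym[symmetric]) (simp add: field_simps)
  finally have "(\<Sum>l<p. integral {-pi..pi} (\<lambda>v. arc_map (nanotube_angle_cos p l) v ^ k)) =
      2 * pi * real p * (\<integral>x. dual_armchair_density p x * x ^ k \<partial>lborel)"
    by (simp add: arc_moment_symmetric flip: sum_distrib_left)
  then have "complex_of_real (2 * pi * real p * (\<integral>x. dual_armchair_density p x * x ^ k \<partial>lborel)) =
      2 * of_real pi * of_nat p * dual_nanotube_moment p p k"
    using dual_nanotube_moment_eq_average[of p k] assms by simp
  then show ?thesis using assms by simp
qed

lemma dual_armchair_density_nonneg: "p \<ge> 2 \<Longrightarrow> 0 \<le> dual_armchair_density p x"
  by (auto simp: dual_armchair_density_eq intro!: divide_nonneg_nonneg add_nonneg_nonneg sum_nonneg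
      arc_density_nonneg abs_nanotube_angle_cos_le_one)

lemma measurable_dual_armchair_density:
  "p \<ge> 2 \<Longrightarrow> dual_armchair_density p \<in> borel_measurable borel"
  by (subst measurable_cong[OF dual_armchair_density_eq]) simp_all

lemma dual_armchair_density_support: "p \<ge> 2 \<Longrightarrow> x \<notin> {0..9} \<Longrightarrow> dual_armchair_density p x = 0"
  using arc_density_support[OF abs_nanotube_angle_cos_le_one]
  by (simp add: dual_armchair_density_eq arc_density_support)

text \<open>The definite description requires existence, which the computed moments provide, and
  uniqueness, which follows from determinacy by moments.\<close>

lemma dual_nanotube_law_diagonal:
  assumes "p \<ge> 2"
  shows "dual_nanotube_law p p = density lborel (\<lambda>x. ennreal (dual_armchair_density p x))"
    (is "_ = ?N")
  unfolding dual_nanotube_law_def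
proof (rule the_equality)
  note [measurable] = measurable_dual_armchair_density[OF assms]
  note nonneg = dual_armchair_density_nonneg[OF assms]
  have moment: "complex_of_real (\<integral>x. x ^ k \<partial>?N) = dual_nanotube_moment p p k" for k
    using dual_armchair_density_moment[OF assms, of k]
    by (subst integral_real_density) (auto simp: nonneg)
  \<comment> \<open>The moment of order 0 gives the total mass of the mixture: half of 1 + 1, plus
    \<open>p - 1\<close>, divided by \<open>p\<close>.\<close>
  have "arc_moment a 0 = 1" for a
  proof -
    have "prob_space (uniform_measure lborel {0<..<pi / 2})"
      by (rule prob_space_uniform_measure) auto
    then show ?thesis by (simp add: arc_moment_def prob_space.prob_space)
  qed
  then have "has_bochner_integral lborel (dual_armchair_density p) 1"
    using has_bochner_integral_dual_armchair_density[OF assms, of 0] assms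
    by (simp add: field_simps of_nat_diff)
  then have "(\<integral>\<^sup>+x. ennreal (dual_armchair_density p x) \<partial>lborel) = 1"
    using nn_integral_eq_integral[of lborel "dual_armchair_density p"]
    by (simp add: has_bochner_integral_iff nonneg)
  then have prob: "prob_space ?N"
    by (intro prob_spaceI) (simp add: emeasure_density)
  have supp: "AE x in ?N. x \<in> {0..9}"
    by (subst AE_density) (use dual_armchair_density_support[OF assms] in \<open>force+\<close>)
  show "prob_space ?N \<and> sets ?N = sets borel \<and> (\<exists>K. compact K \<and> (AE x in ?N. x \<in> K)) \<and>
      (\<forall>k. complex_of_real (\<integral>x. x ^ k \<partial>?N) = dual_nanotube_moment p p k)"
    using prob supp moment by (auto intro!: exI[of _ "{0..9}"])
  fix N' assume N': "prob_space N' \<and> sets N' = sets borel \<and> (\<exists>K. compact K \<and> (AE x in N'. x \<in> K)) \<and>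
      (\<forall>k. complex_of_real (\<integral>x. x ^ k \<partial>N') = dual_nanotube_moment p p k)"
  then obtain K where K: "compact K" "AE x in N'. x \<in> K" by auto
  then obtain B where B: "\<And>x. x \<in> K \<Longrightarrow> \<bar>x\<bar> \<le> B"
    using compact_imp_bounded bounded_iff[of K] by auto
  show "N' = ?N"
  proof (rule moments_determine_bounded_distribution)
    show "real_distribution N'" "real_distribution ?N"
      using N' prob by (auto simp: real_distribution_def real_distribution_axioms_def)
    \<comment> \<open>The determinacy lemma takes one bound for both laws: 9 serves the density,
      \<open>B\<close> the competitor.\<close>
    show "AE x in N'. \<bar>x\<bar> \<le> max 9 B"
      using K(2) by eventually_elim (use B in fastforce)
    show "AE x in ?N. \<bar>x\<bar> \<le> max 9 B"
      using supp by eventually_elim auto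
    fix k
    show "(\<integral>x. x ^ k \<partial>N') = (\<integral>x. x ^ k \<partial>?N)"
      using N' moment[of k] by (metis of_real_eq_iff)
  qed
qed

theorem proposition5:
  fixes p :: nat and M :: "'a measure" and \<Lambda> :: "'a \<Rightarrow> real"
  assumes "p \<ge> 2"
    and "prob_space M"
    and "\<Lambda> \<in> borel_measurable M"
    and "distr M borel \<Lambda> = dual_nanotube_law p p"
  shows "distributed M lborel \<Lambda> (\<lambda>x. ennreal (dual_armchair_density p x)) \<and>
         (\<forall>j\<in>{1..p - 1}.
           distributed (uniform_measure lborel {0<..<pi / 2}) lborel
             (\<lambda>v. 4 * (cos v)\<^sup>2 + 4 * nanotube_angle_cos p j * cos v + 1)
             (\<lambda>x. ennreal (dual_armchair_f p j x)))"
proof (intro conjI ballI)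
  \<comment> \<open>\<open>distributed\<close> refers to the target \<open>lborel\<close>, the
    hypothesis to \<open>borel\<close>; the push-forward depends only on their common Borel
    sets.\<close>
  have "distr M lborel \<Lambda> = distr M borel \<Lambda>"
    by (rule distr_cong) auto
  then show "distributed M lborel \<Lambda> (\<lambda>x. ennreal (dual_armchair_density p x))"
    using assms measurable_dual_armchair_density[OF assms(1)]
    by (simp add: distributed_def dual_nanotube_law_diagonal)
next
  fix j assume "j \<in> {1..p - 1}"
  then have "dual_armchair_f p j = arc_density (nanotube_angle_cos p j)"
    using assms(1) by (intro dual_armchair_f_eq) auto
  then show "distributed (uniform_measure lborel {0<..<pi / 2}) lborel
      (\<lambda>v. 4 * (cos v)\<^sup>2 + 4 * nanotube_angle_cos p j * cos v + 1) (\<lambda>x. ennreal (dual_armchair_f p j x))"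
    by (simp add: distributed_arc_map abs_nanotube_angle_cos_le_one)
qed

end
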